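(* A graph $\Gamma$ admits a non-trivial chromatically invariant $2$-edge-colouring in which every vertex is incident with both a red edge and a blue edge if and only if $\Gamma$ is the join of two graphs, each of which has no isolated vertices.
   Context: All graphs are finite, simple, with nonempty vertex set. The join $\Gamma_1\vee\Gamma_2$ of graphs $\Gamma_1,\Gamma_2$ is their disjoint union together with all edges between $V(\Gamma_1)$ and $V(\Gamma_2)$. A $2$-edge-colouring of $\Gamma$ is a triple $G=(\Gamma,R,B)$ with $R,B\subseteq E(\Gamma)$, $R\cap B=\emptyset$, $R\cup B=E(\Gamma)$ (red and blue edges). A $k$-colouring of $G$ is a proper vertex colouring $c:V(\Gamma)\to\{1,\dots,k\}$ of $\Gamma$ such that for every $ux\in R$ and $vy\in B$ (either endpoint may play the role of $u$, resp. $v$), $c(u)=c(v)$ implies $c(x)\ne c(y)$. $P(G,\lambda)$ is the polynomial whose value at each non-negative integer $k$ is the number of $k$-colourings of $G$. $G$ is chromatically invariant if $P(G,\lambda)=P(\Gamma,\lambda)$ (usual chromatic polynomial of $\Gamma$), and non-trivially chromatically invariant if moreover $R\ne\emptyset$ and $B\ne\emptyset$. *)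

theory Defs
  imports "HOL-Computational_Algebra.Polynomial" "HOL-Library.FuncSet" "HOL-Library.Ramsey"
begin

section \<open>Graphs\<close>

record 'a ugraph =
  verts :: "'a set"
  edges :: "'a set set"

text \<open>Here \<open>[V]\<^bsup>2\<^esup>\<close> is \<^const>\<open>nsets\<close>, the set of all two-element subsets of \<open>V\<close>.\<close>

definition simple_graph :: "'a ugraph \<Rightarrow> bool" where
  "simple_graph \<Gamma> \<longleftrightarrow> finite (verts \<Gamma>) \<and> verts \<Gamma> \<noteq> {} \<and> edges \<Gamma> \<subseteq> [verts \<Gamma>]\<^bsup>2\<^esup>"

definition isolated :: "'a ugraph \<Rightarrow> 'a \<Rightarrow> bool" where
  "isolated \<Gamma> v \<longleftrightarrow> v \<in> verts \<Gamma> \<and> \<not> (\<exists>e\<in>edges \<Gamma>. v \<in> e)"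

text \<open>This is the join only for graphs with disjoint vertex sets, so that the union is a
  disjoint union; disjointness is required separately wherever \<open>graph_join\<close> is used.\<close>

definition graph_join :: "'a ugraph \<Rightarrow> 'a ugraph \<Rightarrow> 'a ugraph" where
  "graph_join \<Gamma>\<^sub>1 \<Gamma>\<^sub>2 =
     \<lparr> verts = verts \<Gamma>\<^sub>1 \<union> verts \<Gamma>\<^sub>2,
       edges = edges \<Gamma>\<^sub>1 \<union> edges \<Gamma>\<^sub>2 \<union> {{u, v} | u v. u \<in> verts \<Gamma>\<^sub>1 \<and> v \<in> verts \<Gamma>\<^sub>2} \<rparr>"

section \<open>Edge colourings and vertex colourings\<close>

definition two_edge_colouring :: "'a ugraph \<Rightarrow> 'a set set \<Rightarrow> 'a set set \<Rightarrow> bool" where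
  "two_edge_colouring \<Gamma> R B \<longleftrightarrow>
     R \<subseteq> edges \<Gamma> \<and> B \<subseteq> edges \<Gamma> \<and> R \<inter> B = {} \<and> R \<union> B = edges \<Gamma>"

text \<open>Colourings are extensional functions, so that each map from \<^term>\<open>verts \<Gamma>\<close> to
  \<^term>\<open>{1..k::nat}\<close> is counted exactly once.\<close>

definition proper_colourings :: "'a ugraph \<Rightarrow> nat \<Rightarrow> ('a \<Rightarrow> nat) set" where
  "proper_colourings \<Gamma> k =
     {c \<in> verts \<Gamma> \<rightarrow>\<^sub>E {1..k}. \<forall>u v. {u, v} \<in> edges \<Gamma> \<longrightarrow> c u \<noteq> c v}"

text \<open>Since \<^term>\<open>{u, x} = {x, u}\<close>, the quantifiers below range over both orientations of
  each red and of each blue edge.\<close>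

definition edge_coloured_colourings ::
  "'a ugraph \<Rightarrow> 'a set set \<Rightarrow> 'a set set \<Rightarrow> nat \<Rightarrow> ('a \<Rightarrow> nat) set" where
  "edge_coloured_colourings \<Gamma> R B k =
     {c \<in> proper_colourings \<Gamma> k.
        \<forall>u x v y. {u, x} \<in> R \<longrightarrow> {v, y} \<in> B \<longrightarrow> c u = c v \<longrightarrow> c x \<noteq> c y}"

section \<open>Chromatic polynomials\<close>

definition counting_poly :: "(nat \<Rightarrow> nat) \<Rightarrow> real poly" where
  "counting_poly N = (THE p. \<forall>k. poly p (real k) = real (N k))"

definition chromatic_poly :: "'a ugraph \<Rightarrow> real poly" where
  "chromatic_poly \<Gamma> = counting_poly (\<lambda>k. card (proper_colourings \<Gamma> k))"

definition edge_coloured_chromatic_poly ::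
  "'a ugraph \<Rightarrow> 'a set set \<Rightarrow> 'a set set \<Rightarrow> real poly" where
  "edge_coloured_chromatic_poly \<Gamma> R B =
     counting_poly (\<lambda>k. card (edge_coloured_colourings \<Gamma> R B k))"

definition chromatically_invariant :: "'a ugraph \<Rightarrow> 'a set set \<Rightarrow> 'a set set \<Rightarrow> bool" where
  "chromatically_invariant \<Gamma> R B \<longleftrightarrow> edge_coloured_chromatic_poly \<Gamma> R B = chromatic_poly \<Gamma>"

definition nontrivially_chromatically_invariant ::
  "'a ugraph \<Rightarrow> 'a set set \<Rightarrow> 'a set set \<Rightarrow> bool" where
  "nontrivially_chromatically_invariant \<Gamma> R B \<longleftrightarrow>
     chromatically_invariant \<Gamma> R B \<and> R \<noteq> {} \<and> B \<noteq> {}"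

section \<open>The polynomials are well defined\<close>

lemma counting_poly_eq:
  assumes p: "\<And>k. poly p (real k) = real (N k)"
  shows "counting_poly N = p"
  unfolding counting_poly_def
proof (rule the_equality)
  show "\<forall>k. poly p (real k) = real (N k)" using p by blast
next
  fix q assume q: "\<forall>k. poly q (real k) = real (N k)"
  have "range real \<subseteq> {x. poly (q - p) x = 0}" using p q by auto
  moreover have "infinite (range real)"
    by (simp add: range_inj_infinite inj_on_def)
  ultimately have "\<not> finite {x. poly (q - p) x = 0}" using finite_subset by blast
  then show "q = p" using poly_roots_finite[of "q - p"] by auto
qed

text \<open>Counting colourings by their image: a property of colourings that is preserved by
  injective renaming of colours yields a polynomial count.\<close>

lemma poly_count_exists:
  fixes A :: "'a set" and Q :: "('a \<Rightarrow> nat) \<Rightarrow> bool"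
  assumes A: "finite A"
    and Q: "\<And>c h. Q c \<Longrightarrow> inj_on h (c ` A) \<Longrightarrow> Q (restrict (h \<circ> c) A)"
  shows "\<exists>p. \<forall>k. poly p (real k) = real (card {c \<in> A \<rightarrow>\<^sub>E {1..k}. Q c})"
proof -
  define F where "F T = {c \<in> A \<rightarrow>\<^sub>E T. Q c \<and> c ` A = T}" for T
  define M where "M j = card (F {1..j})" for j
  have finF: "finite (F T)" if "finite T" for T
    unfolding F_def using finite_PiE[OF A, of "\<lambda>_. T"] that by simp
  have le: "card (F T) \<le> card (F U)" if T: "finite T" "finite U" "card T = card U" for T U
  proof -
    obtain h where h: "bij_betw h T U" using T finite_same_card_bij by blast
    show ?thesis
    proof (rule card_inj_on_le[where f = "\<lambda>c. restrict (h \<circ> c) A"])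
      show "inj_on (\<lambda>c. restrict (h \<circ> c) A) (F T)"
      proof (rule inj_onI)
        fix c d assume c: "c \<in> F T" and d: "d \<in> F T"
          and eq: "restrict (h \<circ> c) A = restrict (h \<circ> d) A"
        show "c = d"
        proof (rule PiE_ext)
          show "c \<in> A \<rightarrow>\<^sub>E T" "d \<in> A \<rightarrow>\<^sub>E T" using c d by (auto simp: F_def)
          fix x assume x: "x \<in> A"
          have "h (c x) = h (d x)" using fun_cong[OF eq, of x] x by simp
          moreover have "c x \<in> T" "d x \<in> T" using c d x by (auto simp: F_def)
          ultimately show "c x = d x" using h by (auto simp: bij_betw_def dest: inj_onD)
        qed
      qed
      show "(\<lambda>c. restrict (h \<circ> c) A) ` F T \<subseteq> F U"
      proof
        fix d assume "d \<in> (\<lambda>c. restrict (h \<circ> c) A) ` F T"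
        then obtain c where c: "c \<in> F T" and d: "d = restrict (h \<circ> c) A" by blast
        have im: "c ` A = T" and Qc: "Q c" using c by (auto simp: F_def)
        have "inj_on h (c ` A)" using h im by (simp add: bij_betw_def)
        then have Qd: "Q d" using Q Qc d by blast
        have "d ` A = h ` (c ` A)" by (auto simp: d)
        then have "d ` A = U" using h im by (simp add: bij_betw_def)
        moreover have "d \<in> A \<rightarrow>\<^sub>E d ` A" using d by auto
        ultimately show "d \<in> F U" using Qd by (simp add: F_def)
      qed
      show "finite (F U)" by (rule finF[OF T(2)])
    qed
  qed
  have eqM: "card (F T) = M (card T)" if "finite T" for T
    unfolding M_def using le[of T "{1..card T}"] le[of "{1..card T}" T] that by auto
  have M0: "M j = 0" if "j > card A" for j
  proof -
    have "F {1..j} = {}"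
    proof (rule ccontr)
      assume "F {1..j} \<noteq> {}"
      then obtain c where "c ` A = {1..j}" by (auto simp: F_def)
      then have "j \<le> card A" using card_image_le[OF A, of c] by simp
      then show False using that by simp
    qed
    then show ?thesis by (simp add: M_def)
  qed
  have count: "card {c \<in> A \<rightarrow>\<^sub>E {1..k}. Q c} = (\<Sum>j\<le>card A. (k choose j) * M j)" for k
  proof -
    have "{c \<in> A \<rightarrow>\<^sub>E {1..k}. Q c} = (\<Union>T\<in>Pow {1..k}. F T)"
      by (auto simp: F_def PiE_iff)
    also have "card \<dots> = (\<Sum>T\<in>Pow {1..k}. card (F T))"
    proof (rule card_UN_disjoint)
      show "\<forall>T\<in>Pow {1..k}. finite (F T)"
        using finF finite_subset[OF _ finite_atLeastAtMost] by blast
    qed (auto simp: F_def)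
    also have "\<dots> = (\<Sum>T\<in>Pow {1..k}. M (card T))"
      by (intro sum.cong refl eqM) (use finite_subset[OF _ finite_atLeastAtMost] in blast)
    also have "\<dots> = (\<Sum>j\<le>k. \<Sum>T\<in>{T \<in> Pow {1..k}. card T = j}. M (card T))"
      by (rule sum.group[symmetric]) (auto dest: card_mono[rotated])
    also have "\<dots> = (\<Sum>j\<le>k. (k choose j) * M j)"
    proof (intro sum.cong refl)
      fix j
      have "(\<Sum>T\<in>{T \<in> Pow {1..k}. card T = j}. M (card T))
          = card {T. T \<subseteq> {1..k} \<and> card T = j} * M j" by simp
      then show "(\<Sum>T\<in>{T \<in> Pow {1..k}. card T = j}. M (card T)) = (k choose j) * M j"
        by (simp add: n_subsets)
    qed
    also have "\<dots> = (\<Sum>j\<le>k + card A. (k choose j) * M j)"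
      by (rule sum.mono_neutral_left) auto
    also have "\<dots> = (\<Sum>j\<le>card A. (k choose j) * M j)"
      by (rule sum.mono_neutral_right) (auto simp: M0)
    finally show ?thesis .
  qed
  define p :: "real poly" where
    "p = (\<Sum>j\<le>card A. smult (real (M j) / fact j) (\<Prod>i<j. [:- real i, 1:]))"
  have "poly p (real k) = real (card {c \<in> A \<rightarrow>\<^sub>E {1..k}. Q c})" for k
    unfolding p_def count
    by (simp add: poly_sum poly_prod binomial_gbinomial gbinomial_prod_rev
        atLeast0LessThan mult.commute)
  then show ?thesis by blast
qed

lemma poly_chromatic_poly:
  assumes "simple_graph \<Gamma>"
  shows "poly (chromatic_poly \<Gamma>) (real k) = real (card (proper_colourings \<Gamma> k))"
proof -
  define Q where "Q c \<longleftrightarrow> (\<forall>u v. {u, v} \<in> edges \<Gamma> \<longrightarrow> c u \<noteq> c v)" for c :: "'a \<Rightarrow> nat"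
  have V: "u \<in> verts \<Gamma> \<and> v \<in> verts \<Gamma>" if "{u, v} \<in> edges \<Gamma>" for u v
    using that assms by (auto simp: simple_graph_def nsets_def)
  have "\<exists>p. \<forall>k. poly p (real k) = real (card {c \<in> verts \<Gamma> \<rightarrow>\<^sub>E {1..k}. Q c})"
  proof (rule poly_count_exists)
    show "finite (verts \<Gamma>)" using assms by (simp add: simple_graph_def)
    show "Q (restrict (h \<circ> c) (verts \<Gamma>))" if "Q c" "inj_on h (c ` verts \<Gamma>)"
      for c and h :: "nat \<Rightarrow> nat"
      unfolding Q_def
    proof (intro allI impI)
      fix u v assume e: "{u, v} \<in> edges \<Gamma>"
      then have "c u \<noteq> c v" using that(1) by (simp add: Q_def)
      then show "restrict (h \<circ> c) (verts \<Gamma>) u \<noteq> restrict (h \<circ> c) (verts \<Gamma>) v"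
        using V[OF e] that(2) by (auto dest: inj_onD)
    qed
  qed
  then obtain p where "\<And>k. poly p (real k) = real (card (proper_colourings \<Gamma> k))"
    by (auto simp: proper_colourings_def Q_def)
  then show ?thesis
    using counting_poly_eq[of p "\<lambda>k. card (proper_colourings \<Gamma> k)"]
    by (simp add: chromatic_poly_def)
qed

lemma poly_edge_coloured_chromatic_poly:
  assumes "simple_graph \<Gamma>" "two_edge_colouring \<Gamma> R B"
  shows "poly (edge_coloured_chromatic_poly \<Gamma> R B) (real k)
           = real (card (edge_coloured_colourings \<Gamma> R B k))"
proof -
  define Q where "Q c \<longleftrightarrow> (\<forall>u v. {u, v} \<in> edges \<Gamma> \<longrightarrow> c u \<noteq> c v) \<and>
      (\<forall>u x v y. {u, x} \<in> R \<longrightarrow> {v, y} \<in> B \<longrightarrow> c u = c v \<longrightarrow> c x \<noteq> c y)" for c :: "'a \<Rightarrow> nat"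
  have V: "u \<in> verts \<Gamma> \<and> v \<in> verts \<Gamma>" if "{u, v} \<in> edges \<Gamma>" for u v
    using that assms by (auto simp: simple_graph_def nsets_def)
  have RB: "u \<in> verts \<Gamma> \<and> v \<in> verts \<Gamma>" if "{u, v} \<in> R \<or> {u, v} \<in> B" for u v
    using that assms V by (auto simp: two_edge_colouring_def)
  have "\<exists>p. \<forall>k. poly p (real k) = real (card {c \<in> verts \<Gamma> \<rightarrow>\<^sub>E {1..k}. Q c})"
  proof (rule poly_count_exists)
    show "finite (verts \<Gamma>)" using assms by (simp add: simple_graph_def)
    fix c and h :: "nat \<Rightarrow> nat" assume Qc: "Q c" and h: "inj_on h (c ` verts \<Gamma>)"
    have hD: "c u = c v" if "h (c u) = h (c v)" "u \<in> verts \<Gamma>" "v \<in> verts \<Gamma>" for u v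
      using that h by (auto dest: inj_onD)
    show "Q (restrict (h \<circ> c) (verts \<Gamma>))"
      unfolding Q_def
    proof (intro conjI allI impI)
      fix u v assume e: "{u, v} \<in> edges \<Gamma>"
      then show "restrict (h \<circ> c) (verts \<Gamma>) u \<noteq> restrict (h \<circ> c) (verts \<Gamma>) v"
        using V[OF e] hD[of u v] Qc by (auto simp: Q_def)
    next
      fix u x v y
      assume r: "{u, x} \<in> R" and b: "{v, y} \<in> B"
        and eq: "restrict (h \<circ> c) (verts \<Gamma>) u = restrict (h \<circ> c) (verts \<Gamma>) v"
      have m: "u \<in> verts \<Gamma>" "x \<in> verts \<Gamma>" "v \<in> verts \<Gamma>" "y \<in> verts \<Gamma>" using RB r b by auto
      have "c u = c v" using eq m hD by simp
      then have "c x \<noteq> c y" using Qc r b unfolding Q_def by blast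
      then show "restrict (h \<circ> c) (verts \<Gamma>) x \<noteq> restrict (h \<circ> c) (verts \<Gamma>) y"
        using m hD[of x y] by auto
    qed
  qed
  then obtain p where p: "\<And>k. poly p (real k) = real (card {c \<in> verts \<Gamma> \<rightarrow>\<^sub>E {1..k}. Q c})"
    by blast
  have "{c \<in> verts \<Gamma> \<rightarrow>\<^sub>E {1..k}. Q c} = edge_coloured_colourings \<Gamma> R B k" for k
    by (auto simp: edge_coloured_colourings_def proper_colourings_def Q_def)
  then have "\<And>k. poly p (real k) = real (card (edge_coloured_colourings \<Gamma> R B k))"
    using p by simp
  then show ?thesis
    using counting_poly_eq[of p "\<lambda>k. card (edge_coloured_colourings \<Gamma> R B k)"]
    by (simp add: edge_coloured_chromatic_poly_def)
qed

end

theory Submission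
  imports Defs
begin

text \<open>
  Identifying the two ends of non-adjacent pairs shows that a 2-edge-colouring is chromatically
  invariant iff any two edges \<open>ux\<close>, \<open>vy\<close> with \<open>u\<close>, \<open>v\<close> non-adjacent (or equal) and \<open>x\<close>, \<open>y\<close>
  non-adjacent (or equal) have the same colour. For a join, colour the edges inside the two sides red
  and the edges between them blue.

  Conversely, call \<open>D\<close> uniform if every common neighbour of \<open>D\<close> sends edges of a single colour to \<open>D\<close>,
  and take a largest uniform set \<open>D\<close> with a nonempty set \<open>Z\<close> of common neighbours. A vertex \<open>w\<close> outside
  \<open>D \<union> Z\<close> is non-adjacent to all of \<open>Z\<close>, for otherwise \<open>D \<union> {w}\<close> would be a larger such set; but
  then all edges at \<open>w\<close> have the colour of the edges from any \<open>z \<in> Z\<close> to \<open>D\<close>, which is impossible.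
  So the graph is the join of \<open>D\<close> and \<open>Z\<close>. No vertex is isolated in \<open>Z\<close>, and if one is isolated in
  \<open>D\<close>, then \<open>Z\<close> splits further, by the colour of its edges to \<open>D\<close>, into a join of nonempty parts \<open>P\<close>
  and \<open>Q\<close>, and \<open>(D \<union> P, Q)\<close> or \<open>(D \<union> Q, P)\<close> is as desired.
\<close>

section \<open>Uniform sets of vertices\<close>

text \<open>Blue is encoded as adjacent and not \<open>red\<close>. \<open>transfer\<close> is the
  combinatorial form of chromatic invariance; since \<open>adj\<close> is irreflexive, it also
  covers the cases \<open>u = v\<close> and \<open>x = y\<close>.\<close>

locale invariant_colouring =
  fixes V :: "'a set" and adj red :: "'a \<Rightarrow> 'a \<Rightarrow> bool"
  assumes finite_V: "finite V" and V_nonempty: "V \<noteq> {}"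
    and adj_V: "adj u v \<Longrightarrow> u \<in> V"
    and adj_sym: "adj u v \<Longrightarrow> adj v u"
    and adj_irrefl: "\<not> adj u u"
    and red_sym: "red u v \<Longrightarrow> red v u"
    and transfer: "\<lbrakk>adj u x; adj v y; \<not> adj u v; \<not> adj x y\<rbrakk> \<Longrightarrow> red u x = red v y"
    and ex_red: "v \<in> V \<Longrightarrow> \<exists>u. adj v u \<and> red v u"
    and ex_blue: "v \<in> V \<Longrightarrow> \<exists>u. adj v u \<and> \<not> red v u"
begin

text \<open>The single colour may vary with the common neighbour \<open>z\<close>. Sets without a
  common neighbour satisfy this vacuously, so the existence of one is demanded separately
  below.\<close>

definition uniform :: "'a set \<Rightarrow> bool" where
  "uniform D \<longleftrightarrow> (\<forall>z. (\<forall>d\<in>D. adj z d) \<longrightarrow> (\<forall>d\<in>D. \<forall>d'\<in>D. red z d = red z d'))"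

text \<open>For a common neighbour \<open>z\<close>, the edges \<open>zw\<close> and
  \<open>zd\<close> share the end \<open>z\<close> and have non-adjacent other ends, so
  \<open>transfer\<close> gives them the same colour.\<close>

lemma uniform_insert:
  assumes "uniform D" "d \<in> D" "\<not> adj w d"
  shows "uniform (insert w D)"
  unfolding uniform_def
proof (intro allI impI)
  fix z assume z: "\<forall>d\<in>insert w D. adj z d"
  have D: "\<forall>e\<in>D. red z e = red z d" using assms(1,2) z unfolding uniform_def by blast
  have "red z w = red z d"
    by (rule transfer) (use z assms adj_irrefl in auto)
  then show "\<forall>e\<in>insert w D. \<forall>e'\<in>insert w D. red z e = red z e'" using D by simp
qed

lemma ex_uniform_join:
  "\<exists>D. D \<subseteq> V \<and> D \<noteq> {} \<and> V - D \<noteq> {} \<and> uniform D \<and> (\<forall>z\<in>V - D. \<forall>d\<in>D. adj z d)"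
proof -
  define \<D> where "\<D> = {D. D \<subseteq> V \<and> D \<noteq> {} \<and> uniform D \<and> (\<exists>z. \<forall>d\<in>D. adj z d)}"
  obtain v where "v \<in> V" using V_nonempty by blast
  then obtain u where "adj v u" using ex_red by blast
  \<comment> \<open>Singletons are trivially uniform, and \<open>v\<close> is a common neighbour of
    \<open>{u}\<close>.\<close>
  then have "{u} \<in> \<D>" using adj_V adj_sym by (auto simp: \<D>_def uniform_def)
  moreover have "finite \<D>"
    by (rule finite_subset[of _ "Pow V"]) (auto simp: \<D>_def finite_V)
  ultimately have "Max (card ` \<D>) \<in> card ` \<D>" and Max: "\<forall>n\<in>card ` \<D>. n \<le> Max (card ` \<D>)"
    by (auto intro!: Max_in)
  then obtain D where D: "D \<in> \<D>" "Max (card ` \<D>) = card D" by blast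
  then have max: "card D' \<le> card D" if "D' \<in> \<D>" for D' using Max that by simp
  have "D \<subseteq> V" "D \<noteq> {}" and uni: "uniform D" using D(1) by (auto simp: \<D>_def)
  have finD: "finite D" using \<open>D \<subseteq> V\<close> finite_V finite_subset by blast
  obtain z where z: "\<forall>d\<in>D. adj z d" using D(1) by (auto simp: \<D>_def)
  have zV: "z \<in> V" "z \<notin> D" using z \<open>D \<noteq> {}\<close> adj_V adj_irrefl by blast+
  \<comment> \<open>Otherwise \<open>y\<close> would be a common neighbour of the larger uniform set
    \<open>insert w D\<close>, against maximality.\<close>
  have far: "\<not> adj w y" if w: "w \<in> V - D" "d \<in> D" "\<not> adj w d" and y: "\<forall>d\<in>D. adj y d" for w d y
  proof
    assume "adj w y"
    then have "insert w D \<in> \<D>"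
      using w y \<open>D \<subseteq> V\<close> uniform_insert[OF uni] adj_sym unfolding \<D>_def by blast
    then show False using max[of "insert w D"] w finD by simp
  qed
  have "adj w d" if w: "w \<in> V - D" "d \<in> D" for w d
  proof (rule ccontr)
    assume nadj: "\<not> adj w d"
    have col: "red w u = red z d" if u: "adj w u" for u
    proof -
      have wz: "\<not> adj w z" using far[OF w nadj z] .
      have eq: "red z e = red z d" if "e \<in> D" for e
        using uni z w that unfolding uniform_def by blast
      \<comment> \<open>If \<open>u\<close> lies in \<open>D\<close>, it serves as \<open>e\<close>
        itself. If not, \<open>far\<close> shows that \<open>u\<close>, being adjacent to
        \<open>w\<close>, is not a common neighbour of \<open>D\<close>. Then
        \<open>transfer\<close> compares \<open>wu\<close> with \<open>ze\<close>.\<close>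
      obtain e where e: "e \<in> D" "\<not> adj u e"
      proof (cases "u \<in> D")
        case True
        then show ?thesis using that adj_irrefl by blast
      next
        case False
        then show ?thesis using that far[OF w nadj, of u] u by blast
      qed
      have "red w u = red z e" by (rule transfer) (use u e z wz in auto)
      then show ?thesis using eq e by simp
    qed
    show False using ex_red[of w] ex_blue[of w] col w by blast
  qed
  then show ?thesis using \<open>D \<subseteq> V\<close> \<open>D \<noteq> {}\<close> zV uni by blast
qed

text \<open>Suppose \<open>p\<close> is isolated in \<open>P\<close> and \<open>q\<close> in
  \<open>Q\<close>. Edges from \<open>p\<close> to \<open>A\<close> have colour \<open>r\<close>, so
  \<open>p\<close> has an edge of the other colour to some \<open>q'\<close> in \<open>Q\<close>; as
  \<open>q\<close> and \<open>q'\<close> are not adjacent, \<open>pq\<close> has that colour too. By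
  symmetry \<open>pq\<close> also has colour \<open>r\<close>, a contradiction.\<close>

lemma no_isolated_in_part:
  assumes part: "V = A \<union> P \<union> Q"
    and AP: "\<And>a p. a \<in> A \<Longrightarrow> p \<in> P \<Longrightarrow> adj a p \<and> red a p = r"
    and AQ: "\<And>a q. a \<in> A \<Longrightarrow> q \<in> Q \<Longrightarrow> adj a q \<and> red a q = (\<not> r)"
    and PQ: "\<And>p q. p \<in> P \<Longrightarrow> q \<in> Q \<Longrightarrow> adj p q"
  shows "(\<forall>p\<in>P. \<exists>p'\<in>P. adj p p') \<or> (\<forall>q\<in>Q. \<exists>q'\<in>Q. adj q q')"
proof (rule ccontr)
  assume "\<not> ?thesis"
  then obtain p q where p: "p \<in> P" "\<forall>p'\<in>P. \<not> adj p p'" and q: "q \<in> Q" "\<forall>q'\<in>Q. \<not> adj q q'"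
    by blast
  have both: "\<exists>u. adj v u \<and> red v u = s" if "v \<in> V" for v s
    using ex_red ex_blue that by (cases s) auto
  obtain q' where q': "adj p q'" "red p q' = (\<not> r)" using both[of p "\<not> r"] p part by auto
  have "q' \<in> Q" using q' p AP[of q' p] adj_V[OF adj_sym, of p q'] part red_sym by blast
  obtain p' where p': "adj q p'" "red q p' = r" using both[of q r] q part by auto
  have "p' \<in> P" using p' q AQ[of p' q] adj_V[OF adj_sym, of q p'] part red_sym by blast
  have "red p q = red p q'"
    by (rule transfer) (use p q q' PQ \<open>q' \<in> Q\<close> adj_irrefl in auto)
  moreover have "red q p = red q p'"
    by (rule transfer) (use p q p' PQ \<open>p' \<in> P\<close> adj_irrefl adj_sym in auto)
  ultimately show False using q' p' red_sym by blast
qed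

theorem ex_join_partition:
  "\<exists>A B. A \<noteq> {} \<and> B \<noteq> {} \<and> A \<inter> B = {} \<and> V = A \<union> B \<and> (\<forall>a\<in>A. \<forall>b\<in>B. adj a b) \<and>
     (\<forall>a\<in>A. \<exists>a'\<in>A. adj a a') \<and> (\<forall>b\<in>B. \<exists>b'\<in>B. adj b b')"
proof -
  obtain D where D: "D \<subseteq> V" "D \<noteq> {}" "V - D \<noteq> {}" "uniform D"
    and joined: "\<forall>z\<in>V - D. \<forall>d\<in>D. adj z d"
    using ex_uniform_join by auto
  have join: "adj z d" if "z \<in> V - D" "d \<in> D" for z d using joined that by simp
  have uni: "red z d = red z e" if "z \<in> V - D" "d \<in> D" "e \<in> D" for z d e
    using D(4) join that unfolding uniform_def by blast
  \<comment> \<open>A vertex with all its neighbours in \<open>D\<close> would see only one colour,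
    by uniformity.\<close>
  have Z: "\<exists>z'\<in>V - D. adj z z'" if z: "z \<in> V - D" for z
  proof (rule ccontr)
    assume "\<not> ?thesis"
    then have inD: "u \<in> D" if "adj z u" for u using that adj_V adj_sym by blast
    obtain u w where "adj z u" "red z u" "adj z w" "\<not> red z w" using ex_red ex_blue z by blast
    then show False using uni[OF z] inD by blast
  qed
  show ?thesis
  proof (cases "\<forall>d\<in>D. \<exists>d'\<in>D. adj d d'")
    case True
    moreover have "\<forall>d\<in>D. \<forall>z\<in>V - D. adj d z" using join adj_sym by blast
    moreover have "D \<inter> (V - D) = {}" "V = D \<union> (V - D)" using D(1) by auto
    ultimately show ?thesis using D(2,3) Z by (intro exI[of _ D] exI[of _ "V - D"]) simp
  next
    case False
    then obtain d where d: "d \<in> D" "\<And>d'. d' \<in> D \<Longrightarrow> \<not> adj d d'" by blast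
    define P where "P = {z \<in> V - D. red z d}"
    define Q where "Q = {z \<in> V - D. \<not> red z d}"
    \<comment> \<open>All neighbours of \<open>d\<close> lie outside \<open>D\<close>, so its red
      and blue edges show that \<open>P\<close> and \<open>Q\<close> are nonempty.\<close>
    obtain u w where uw: "adj d u" "red d u" "adj d w" "\<not> red d w"
      using ex_red ex_blue d(1) D(1) by blast
    then have "u \<in> V - D" "w \<in> V - D" using d(2) adj_V adj_sym by blast+
    then have "u \<in> P" "w \<in> Q" using uw red_sym unfolding P_def Q_def by blast+
    \<comment> \<open>If \<open>p\<close> and \<open>q\<close> were not adjacent,
      \<open>transfer\<close> would give \<open>pd\<close> and \<open>qd\<close> the same
      colour.\<close>
    have PQ: "adj p q" if "p \<in> P" "q \<in> Q" for p q
      using transfer[of p d q d] join d(1) adj_irrefl that unfolding P_def Q_def by blast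
    have DP: "adj e p \<and> red e p" if "e \<in> D" "p \<in> P" for e p
      using that d(1) uni[of p d e] join adj_sym red_sym unfolding P_def by blast
    have DQ: "adj e q \<and> \<not> red e q" if "e \<in> D" "q \<in> Q" for e q
      using that d(1) uni[of q d e] join adj_sym red_sym unfolding Q_def by blast
    have part: "V = D \<union> P \<union> Q" and disj: "D \<inter> P = {}" "D \<inter> Q = {}" "P \<inter> Q = {}"
      using D(1) by (auto simp: P_def Q_def)
    have "(\<forall>p\<in>P. \<exists>p'\<in>P. adj p p') \<or> (\<forall>q\<in>Q. \<exists>q'\<in>Q. adj q q')"
      by (rule no_isolated_in_part[OF part, of True]) (use DP DQ PQ in auto)
    then show ?thesis
    proof
      assume P: "\<forall>p\<in>P. \<exists>p'\<in>P. adj p p'"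
      \<comment> \<open>Complete adjacency between the nonempty sets \<open>D\<close> and
        \<open>Q\<close> leaves no isolated vertex in their union.\<close>
      have "\<forall>a\<in>D \<union> Q. \<exists>a'\<in>D \<union> Q. adj a a'"
        using d(1) \<open>w \<in> Q\<close> DQ adj_sym by blast
      moreover have "\<forall>a\<in>D \<union> Q. \<forall>b\<in>P. adj a b" using DP PQ adj_sym by blast
      moreover have "(D \<union> Q) \<inter> P = {}" "V = (D \<union> Q) \<union> P" using part disj by auto
      ultimately show ?thesis
        using D(2) P \<open>u \<in> P\<close> \<open>w \<in> Q\<close> by (intro exI[of _ "D \<union> Q"] exI[of _ P]) blast
    next
      assume Q: "\<forall>q\<in>Q. \<exists>q'\<in>Q. adj q q'"
      have "\<forall>a\<in>D \<union> P. \<exists>a'\<in>D \<union> P. adj a a'"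
        using d(1) \<open>u \<in> P\<close> DP adj_sym by blast
      moreover have "\<forall>a\<in>D \<union> P. \<forall>b\<in>Q. adj a b" using DQ PQ adj_sym by blast
      moreover have "(D \<union> P) \<inter> Q = {}" "V = (D \<union> P) \<union> Q" using part disj by auto
      ultimately show ?thesis
        using D(2) Q \<open>u \<in> P\<close> \<open>w \<in> Q\<close> by (intro exI[of _ "D \<union> P"] exI[of _ Q]) blast
    qed
  qed
qed

end

section \<open>Chromatic invariance\<close>

lemma simple_graph_edgeD:
  assumes "simple_graph \<Gamma>" "{u, v} \<in> edges \<Gamma>"
  shows "u \<in> verts \<Gamma>" "v \<in> verts \<Gamma>" "u \<noteq> v"
  using assms by (auto simp: simple_graph_def nsets_def)

lemma simple_graph_edgeE:
  assumes "simple_graph \<Gamma>" "e \<in> edges \<Gamma>"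
  obtains u v where "e = {u, v}"
proof -
  have "card e = 2" using assms by (auto simp: simple_graph_def nsets_def)
  then show ?thesis using that by (auto simp: card_2_iff)
qed

text \<open>The restricted colourings form a subset of the finite set of proper ones, so equal
  counts for each \<open>k\<close> force equal sets.\<close>

lemma chromatically_invariant_iff_colourings:
  assumes "simple_graph \<Gamma>" "two_edge_colouring \<Gamma> R B"
  shows "chromatically_invariant \<Gamma> R B
     \<longleftrightarrow> (\<forall>k. edge_coloured_colourings \<Gamma> R B k = proper_colourings \<Gamma> k)"
proof
  assume inv: "chromatically_invariant \<Gamma> R B"
  show "\<forall>k. edge_coloured_colourings \<Gamma> R B k = proper_colourings \<Gamma> k"
  proof
    fix k :: nat
    have "finite (verts \<Gamma> \<rightarrow>\<^sub>E {1..k})"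
      using assms(1) by (simp add: finite_PiE simple_graph_def)
    then have "finite (proper_colourings \<Gamma> k)" by (simp add: proper_colourings_def)
    moreover have "edge_coloured_colourings \<Gamma> R B k \<subseteq> proper_colourings \<Gamma> k"
      by (auto simp: edge_coloured_colourings_def)
    moreover have "card (edge_coloured_colourings \<Gamma> R B k) = card (proper_colourings \<Gamma> k)"
      using inv poly_chromatic_poly[OF assms(1), of k] poly_edge_coloured_chromatic_poly[OF assms, of k]
      by (simp add: chromatically_invariant_def)
    ultimately show "edge_coloured_colourings \<Gamma> R B k = proper_colourings \<Gamma> k"
      by (rule card_subset_eq)
  qed
next
  assume "\<forall>k. edge_coloured_colourings \<Gamma> R B k = proper_colourings \<Gamma> k"
  then show "chromatically_invariant \<Gamma> R B"
    by (simp add: chromatically_invariant_def chromatic_poly_def edge_coloured_chromatic_poly_def)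
qed

text \<open>Give every vertex its own colour, except that \<open>v\<close> takes the colour of
  \<open>u\<close> and \<open>y\<close> that of \<open>x\<close>; only non-adjacent vertices are
  identified. The cases \<open>u = v\<close> and \<open>x = y\<close> are included.\<close>

lemma ex_identifying_colouring:
  assumes \<Gamma>: "simple_graph \<Gamma>"
    and e: "{u, x} \<in> edges \<Gamma>" "{v, y} \<in> edges \<Gamma>" "{u, v} \<notin> edges \<Gamma>" "{x, y} \<notin> edges \<Gamma>"
  obtains k c where "c \<in> proper_colourings \<Gamma> k" "c u = c v" "c x = c y"
proof -
  let ?V = "verts \<Gamma>"
  note V = simple_graph_edgeD[OF \<Gamma>]
  have "finite ?V" using \<Gamma> by (simp add: simple_graph_def)
  then obtain g where "bij_betw g ?V {1..card ?V}"
    using finite_same_card_bij[of ?V "{1..card ?V}"] by auto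
  then have g: "inj_on g ?V" "g ` ?V = {1..card ?V}" by (auto simp: bij_betw_def)
  define \<phi> where "\<phi> t = (if t = v then u else if t = y then x else t)" for t
  define c where "c = restrict (g \<circ> \<phi>) ?V"
  have uxvy: "u \<in> ?V" "x \<in> ?V" "v \<in> ?V" "y \<in> ?V" "u \<noteq> x" "v \<noteq> y" using e V by blast+
  \<comment> \<open>Either equality would make \<open>{u, v}\<close> an edge. Hence
    \<open>\<phi>\<close> fixes \<open>u\<close> and \<open>x\<close>, and the two identifications
    do not interfere.\<close>
  have "u \<noteq> y" "x \<noteq> v" using e by (auto simp: insert_commute)
  have \<phi>V: "\<phi> t \<in> ?V" if "t \<in> ?V" for t using that uxvy by (simp add: \<phi>_def)
  have \<phi>: "\<phi> s \<noteq> \<phi> t" if st: "{s, t} \<in> edges \<Gamma>" for s t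
  proof
    assume "\<phi> s = \<phi> t"
    then have "s = t \<or> {s, t} = {u, v} \<or> {s, t} = {x, y}"
      using uxvy \<open>u \<noteq> y\<close> \<open>x \<noteq> v\<close> by (auto simp: \<phi>_def insert_commute split: if_splits)
    then show False using st e(3,4) V(3)[OF st] by auto
  qed
  have "c \<in> proper_colourings \<Gamma> (card ?V)"
    unfolding proper_colourings_def
  proof (intro CollectI conjI allI impI)
    show "c \<in> ?V \<rightarrow>\<^sub>E {1..card ?V}" using \<phi>V g(2) by (auto simp: c_def simp del: atLeastAtMost_iff)
    show "c s \<noteq> c t" if st: "{s, t} \<in> edges \<Gamma>" for s t
      using \<phi>[OF st] \<phi>V V(1,2)[OF st] inj_onD[OF g(1)] by (auto simp: c_def)
  qed
  moreover have "c u = c v" "c x = c y"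
    using uxvy \<open>u \<noteq> y\<close> \<open>x \<noteq> v\<close> by (auto simp: c_def \<phi>_def)
  ultimately show ?thesis using that by blast
qed

text \<open>A red and a blue edge violating the condition on the right yield, by
  \<open>ex_identifying_colouring\<close>, a proper colouring that the edge colours forbid.
  Conversely, adjacent ends already differ in every proper colouring.\<close>

lemma chromatically_invariant_iff:
  assumes \<Gamma>: "simple_graph \<Gamma>" and RB: "two_edge_colouring \<Gamma> R B"
  shows "chromatically_invariant \<Gamma> R B
     \<longleftrightarrow> (\<forall>u x v y. {u, x} \<in> R \<longrightarrow> {v, y} \<in> B \<longrightarrow> {u, v} \<in> edges \<Gamma> \<or> {x, y} \<in> edges \<Gamma>)"
    (is "_ \<longleftrightarrow> ?adjacent")
proof
  assume inv: "chromatically_invariant \<Gamma> R B"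
  show ?adjacent
  proof (intro allI impI, rule ccontr)
    fix u x v y
    assume r: "{u, x} \<in> R" and b: "{v, y} \<in> B"
      and "\<not> ({u, v} \<in> edges \<Gamma> \<or> {x, y} \<in> edges \<Gamma>)"
    moreover have "{u, x} \<in> edges \<Gamma>" "{v, y} \<in> edges \<Gamma>"
      using r b RB by (auto simp: two_edge_colouring_def)
    ultimately obtain k c where c: "c \<in> proper_colourings \<Gamma> k" "c u = c v" "c x = c y"
      using ex_identifying_colouring[OF \<Gamma>] by metis
    then have "c \<in> edge_coloured_colourings \<Gamma> R B k"
      using inv chromatically_invariant_iff_colourings[OF assms] by blast
    then show False using c r b unfolding edge_coloured_colourings_def by blast
  qed
next
  assume adj: ?adjacent
  have "proper_colourings \<Gamma> k \<subseteq> edge_coloured_colourings \<Gamma> R B k" for k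
  proof
    fix c assume c: "c \<in> proper_colourings \<Gamma> k"
    then have "c s \<noteq> c t" if "{s, t} \<in> edges \<Gamma>" for s t
      using that by (auto simp: proper_colourings_def)
    then show "c \<in> edge_coloured_colourings \<Gamma> R B k"
      using c adj unfolding edge_coloured_colourings_def by blast
  qed
  then have "edge_coloured_colourings \<Gamma> R B k = proper_colourings \<Gamma> k" for k
    unfolding edge_coloured_colourings_def by blast
  then show "chromatically_invariant \<Gamma> R B"
    using chromatically_invariant_iff_colourings[OF assms] by blast
qed

section \<open>Joins\<close>

definition induced :: "'a ugraph \<Rightarrow> 'a set \<Rightarrow> 'a ugraph" where
  "induced \<Gamma> A = \<lparr>verts = A, edges = {e \<in> edges \<Gamma>. e \<subseteq> A}\<rparr>"

lemma simple_graph_induced: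
  assumes "simple_graph \<Gamma>" "A \<subseteq> verts \<Gamma>" "A \<noteq> {}"
  shows "simple_graph (induced \<Gamma> A)"
  using assms by (auto simp: simple_graph_def induced_def nsets_def intro: finite_subset)

lemma graph_join_induced:
  fixes \<Gamma> :: "'a ugraph"
  assumes \<Gamma>: "simple_graph \<Gamma>" and V: "verts \<Gamma> = A \<union> B"
    and AB: "\<And>a b. a \<in> A \<Longrightarrow> b \<in> B \<Longrightarrow> {a, b} \<in> edges \<Gamma>"
  shows "\<Gamma> = graph_join (induced \<Gamma> A) (induced \<Gamma> B)"
proof -
  have "edges \<Gamma> = edges (graph_join (induced \<Gamma> A) (induced \<Gamma> B))"
  proof (intro set_eqI iffI)
    fix e assume e: "e \<in> edges \<Gamma>"
    then obtain u v where uv: "e = {u, v}" using simple_graph_edgeE[OF \<Gamma>] by blast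
    then have "u \<in> A \<union> B" "v \<in> A \<union> B" using simple_graph_edgeD[OF \<Gamma>] e V by blast+
    moreover have "{u, v} = {v, u}" by blast
    ultimately show "e \<in> edges (graph_join (induced \<Gamma> A) (induced \<Gamma> B))"
      using e unfolding uv graph_join_def induced_def by (simp, blast)
  qed (use AB in \<open>auto simp: graph_join_def induced_def\<close>)
  then show ?thesis using V by (simp add: graph_join_def induced_def)
qed

lemma not_isolated_induced:
  assumes "a' \<in> A" "{a, a'} \<in> edges \<Gamma>"
  shows "\<not> isolated (induced \<Gamma> A) a"
proof
  assume "isolated (induced \<Gamma> A) a"
  then have "a \<in> A" and "{a, a'} \<notin> edges (induced \<Gamma> A)"
    unfolding isolated_def induced_def by (simp, blast)
  then show False using assms by (simp add: induced_def)
qed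

section \<open>The two implications of the equivalence\<close>

lemma join_imp_invariant_colouring:
  assumes \<Gamma>: "simple_graph \<Gamma>" and \<Gamma>\<^sub>1: "simple_graph \<Gamma>\<^sub>1" and \<Gamma>\<^sub>2: "simple_graph \<Gamma>\<^sub>2"
    and disj: "verts \<Gamma>\<^sub>1 \<inter> verts \<Gamma>\<^sub>2 = {}" and join: "\<Gamma> = graph_join \<Gamma>\<^sub>1 \<Gamma>\<^sub>2"
    and iso: "\<forall>v\<in>verts \<Gamma>\<^sub>1. \<not> isolated \<Gamma>\<^sub>1 v" "\<forall>v\<in>verts \<Gamma>\<^sub>2. \<not> isolated \<Gamma>\<^sub>2 v"
  shows "\<exists>R B. two_edge_colouring \<Gamma> R B \<and> nontrivially_chromatically_invariant \<Gamma> R B \<and>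
            (\<forall>v\<in>verts \<Gamma>. (\<exists>e\<in>R. v \<in> e) \<and> (\<exists>e\<in>B. v \<in> e))"
proof -
  define R where "R = edges \<Gamma>\<^sub>1 \<union> edges \<Gamma>\<^sub>2"
  define B where "B = {{u, v} | u v. u \<in> verts \<Gamma>\<^sub>1 \<and> v \<in> verts \<Gamma>\<^sub>2}"
  have ne: "verts \<Gamma>\<^sub>1 \<noteq> {}" "verts \<Gamma>\<^sub>2 \<noteq> {}" using \<Gamma>\<^sub>1 \<Gamma>\<^sub>2 by (auto simp: simple_graph_def)
  have sub: "e \<subseteq> verts \<Gamma>\<^sub>1 \<or> e \<subseteq> verts \<Gamma>\<^sub>2" if "e \<in> R" for e
    using that \<Gamma>\<^sub>1 \<Gamma>\<^sub>2 by (auto simp: R_def simple_graph_def nsets_def)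
  have E: "edges \<Gamma> = R \<union> B" by (simp add: join graph_join_def R_def B_def)
  have "R \<inter> B = {}"
  proof (intro equals0I)
    fix e assume "e \<in> R \<inter> B"
    then show False using sub[of e] disj by (auto simp: B_def)
  qed
  then have RB: "two_edge_colouring \<Gamma> R B" by (auto simp: two_edge_colouring_def E)
  have "chromatically_invariant \<Gamma> R B"
    unfolding chromatically_invariant_iff[OF \<Gamma> RB]
  proof (intro allI impI)
    fix u x v y assume r: "{u, x} \<in> R" and b: "{v, y} \<in> B"
    have cross: "{s, t} \<in> edges \<Gamma>" "{t, s} \<in> edges \<Gamma>" if "s \<in> verts \<Gamma>\<^sub>1" "t \<in> verts \<Gamma>\<^sub>2" for s t
      using that by (auto simp: E B_def)
    \<comment> \<open>The blue edge has an end on each side, while the red edge lies within one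
      side. Whichever of \<open>v\<close> and \<open>y\<close> is opposite the red edge is adjacent
      to both \<open>u\<close> and \<open>x\<close>.\<close>
    have "(v \<in> verts \<Gamma>\<^sub>1 \<and> y \<in> verts \<Gamma>\<^sub>2) \<or> (y \<in> verts \<Gamma>\<^sub>1 \<and> v \<in> verts \<Gamma>\<^sub>2)"
      using b by (auto simp: B_def doubleton_eq_iff)
    then show "{u, v} \<in> edges \<Gamma> \<or> {x, y} \<in> edges \<Gamma>" using sub[OF r] cross by blast
  qed
  moreover have inc: "(\<exists>e\<in>R. v \<in> e) \<and> (\<exists>e\<in>B. v \<in> e)" if "v \<in> verts \<Gamma>" for v
  proof
    have v: "v \<in> verts \<Gamma>\<^sub>1 \<or> v \<in> verts \<Gamma>\<^sub>2" using that by (simp add: join graph_join_def)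
    then show "\<exists>e\<in>R. v \<in> e" using iso unfolding isolated_def R_def by blast
    show "\<exists>e\<in>B. v \<in> e" using v ne unfolding B_def by blast
  qed
  \<comment> \<open>Any single vertex, with its incident red and blue edges, shows that
    \<open>R\<close> and \<open>B\<close> are nonempty.\<close>
  moreover have "verts \<Gamma> \<noteq> {}" using \<Gamma> by (simp add: simple_graph_def)
  ultimately show ?thesis
    using RB unfolding nontrivially_chromatically_invariant_def by blast
qed

lemma invariant_colouring_imp_join:
  fixes \<Gamma> :: "'a ugraph"
  assumes \<Gamma>: "simple_graph \<Gamma>" and RB: "two_edge_colouring \<Gamma> R B"
    and inv: "chromatically_invariant \<Gamma> R B"
    and inc: "\<forall>v\<in>verts \<Gamma>. (\<exists>e\<in>R. v \<in> e) \<and> (\<exists>e\<in>B. v \<in> e)"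
  shows "\<exists>\<Gamma>\<^sub>1 \<Gamma>\<^sub>2. simple_graph \<Gamma>\<^sub>1 \<and> simple_graph \<Gamma>\<^sub>2 \<and> verts \<Gamma>\<^sub>1 \<inter> verts \<Gamma>\<^sub>2 = {} \<and>
            \<Gamma> = graph_join \<Gamma>\<^sub>1 \<Gamma>\<^sub>2 \<and>
            (\<forall>v\<in>verts \<Gamma>\<^sub>1. \<not> isolated \<Gamma>\<^sub>1 v) \<and> (\<forall>v\<in>verts \<Gamma>\<^sub>2. \<not> isolated \<Gamma>\<^sub>2 v)"
proof -
  let ?V = "verts \<Gamma>" and ?adj = "\<lambda>u v. {u, v} \<in> edges \<Gamma>"
  have E: "edges \<Gamma> = R \<union> B" "R \<inter> B = {}" using RB by (auto simp: two_edge_colouring_def)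
  have nbr: "\<exists>u. {v, u} \<in> S" if S: "S \<subseteq> edges \<Gamma>" "e \<in> S" "v \<in> e" for S e v
  proof -
    obtain s t where "e = {s, t}" using simple_graph_edgeE[OF \<Gamma>, of e] S by blast
    then show ?thesis using S(2,3) by (auto simp: insert_commute)
  qed
  interpret invariant_colouring ?V ?adj "\<lambda>u v. {u, v} \<in> R"
  proof
    show "finite ?V" "?V \<noteq> {}" using \<Gamma> by (auto simp: simple_graph_def)
    show "u \<in> ?V" if "?adj u v" for u v using simple_graph_edgeD[OF \<Gamma> that] by blast
    show "\<not> ?adj u u" for u using simple_graph_edgeD(3)[OF \<Gamma>, of u u] by blast
    show "\<exists>u. ?adj v u \<and> {v, u} \<in> R" if v: "v \<in> ?V" for v
    proof -
      obtain e where "e \<in> R" "v \<in> e" using inc v by blast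
      then show ?thesis using nbr[of R e v] E by blast
    qed
    show "\<exists>u. ?adj v u \<and> {v, u} \<notin> R" if v: "v \<in> ?V" for v
    proof -
      obtain e where "e \<in> B" "v \<in> e" using inc v by blast
      then show ?thesis using nbr[of B e v] E by blast
    qed
    show "({u, x} \<in> R) = ({v, y} \<in> R)"
      if "?adj u x" "?adj v y" "\<not> ?adj u v" "\<not> ?adj x y" for u x v y
    proof -
      \<comment> \<open>Either of the two edges might be the red one, so the criterion is needed
        with the edges in both orders.\<close>
      have "{v, u} \<notin> edges \<Gamma>" "{y, x} \<notin> edges \<Gamma>" using that by (auto simp: insert_commute)
      then show ?thesis
        using that inv unfolding chromatically_invariant_iff[OF \<Gamma> RB] E by blast
    qed
  qed (simp_all add: insert_commute)
  obtain A A' where A: "A \<noteq> {}" "A' \<noteq> {}" "A \<inter> A' = {}" "?V = A \<union> A'"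
    and cross: "\<forall>a\<in>A. \<forall>b\<in>A'. ?adj a b"
    and no_iso: "\<forall>a\<in>A. \<exists>a'\<in>A. ?adj a a'" "\<forall>b\<in>A'. \<exists>b'\<in>A'. ?adj b b'"
    using ex_join_partition by auto
  have "\<Gamma> = graph_join (induced \<Gamma> A) (induced \<Gamma> A')"
    using graph_join_induced[OF \<Gamma> A(4)] cross by simp
  moreover have "verts (induced \<Gamma> A) = A" "verts (induced \<Gamma> A') = A'" by (simp_all add: induced_def)
  moreover have "simple_graph (induced \<Gamma> A)" "simple_graph (induced \<Gamma> A')"
    using simple_graph_induced[OF \<Gamma>] A by auto
  moreover have "\<not> isolated (induced \<Gamma> A) v" if "v \<in> A" for v
    using bspec[OF no_iso(1) that] not_isolated_induced by fast
  moreover have "\<not> isolated (induced \<Gamma> A') v" if "v \<in> A'" for v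
    using bspec[OF no_iso(2) that] not_isolated_induced by fast
  ultimately show ?thesis
    using A(3) by (intro exI[of _ "induced \<Gamma> A"] exI[of _ "induced \<Gamma> A'"]) simp
qed

theorem theorem13:
  fixes \<Gamma> :: "'a ugraph"
  assumes "simple_graph \<Gamma>"
  shows "(\<exists>R B. two_edge_colouring \<Gamma> R B \<and> nontrivially_chromatically_invariant \<Gamma> R B \<and>
            (\<forall>v\<in>verts \<Gamma>. (\<exists>e\<in>R. v \<in> e) \<and> (\<exists>e\<in>B. v \<in> e)))
     \<longleftrightarrow> (\<exists>\<Gamma>\<^sub>1 \<Gamma>\<^sub>2. simple_graph \<Gamma>\<^sub>1 \<and> simple_graph \<Gamma>\<^sub>2 \<and> verts \<Gamma>\<^sub>1 \<inter> verts \<Gamma>\<^sub>2 = {} \<and>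
            \<Gamma> = graph_join \<Gamma>\<^sub>1 \<Gamma>\<^sub>2 \<and>
            (\<forall>v\<in>verts \<Gamma>\<^sub>1. \<not> isolated \<Gamma>\<^sub>1 v) \<and> (\<forall>v\<in>verts \<Gamma>\<^sub>2. \<not> isolated \<Gamma>\<^sub>2 v))"
    (is "?coloured \<longleftrightarrow> ?join")
proof
  assume ?coloured
  then show ?join
    using invariant_colouring_imp_join[OF assms]
    unfolding nontrivially_chromatically_invariant_def by blast
next
  assume ?join
  then show ?coloured using join_imp_invariant_colouring[OF assms] by blast
qed

end
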